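(* Let $(\mathbf S,\mathcal A,\to)$ be a PTS. For all processes $s,t\in\mathbf S$ and every $k\in\mathbb N$, $t\models\vartheta_s^k$ if and only if $s\sqsubseteq_k t$. Moreover, if $s$ is finite, then $t\models\vartheta_s$ if and only if $s\sqsubseteq t$.
   Context: A PTS is a triple $(\mathbf S,\mathcal A,\to)$ with $\mathbf S$ a countable set of processes, $\mathcal A$ a countable set of actions and $\to\subseteq\mathbf S\times\mathcal A\times\Delta(\mathbf S)$, where $\Delta(\mathbf S)$ is the set of probability distributions on $\mathbf S$ with finite support. Write $s\xrightarrow{a}\pi$ for $(s,a,\pi)\in\to$; $\mathrm{init}(s)=\{a\mid\exists\pi.\ s\xrightarrow a\pi\}$; $\mathrm{der}(s,a)=\{\pi\mid s\xrightarrow a\pi\}$; $\mathrm{supp}(\pi)=\{t\mid\pi(t)>0\}$; $\delta_s$ is the Dirac distribution. The depth of $s$ is $0$ if $\mathrm{init}(s)=\emptyset$, otherwise $1+\sup\{\mathrm{depth}(t)\mid a\in\mathrm{init}(s),\pi\in\mathrm{der}(s,a),t\in\mathrm{supp}(\pi)\}$. A process is finite if $\mathrm{der}(s,a)$ is finite for all $a$ and its depth is finite. Lifting: for $R\subseteq\mathbf S\times\mathbf S$, $\pi R^\dagger\pi'$ iff there are an index set $I$, weights $p_i$ and $s_i,t_i$ with $\pi=\sum_ip_i\delta_{s_i}$, $\pi'=\sum_ip_i\delta_{t_i}$, $s_iRt_i$ for all $i$. A probabilistic simulation is $R$ such that $sRt$ and $s\xrightarrow a\pi_s$ imply $t\xrightarrow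 a\pi_t$ for some $\pi_t$ with $\pi_sR^\dagger\pi_t$; $\sqsubseteq$ is the union of all probabilistic simulations. Up-to-$k$ simulations: $\sqsubseteq_0=\mathbf S\times\mathbf S$; $s\sqsubseteq_{k+1}t$ iff whenever $s\xrightarrow a\pi_s$ there is $t\xrightarrow a\pi_t$ with $\pi_s\sqsubseteq_k^\dagger\pi_t$. Logic and satisfaction: state formulae $\varphi::=\top\mid\neg\varphi\mid\bigwedge_{j\in J}\varphi_j\mid\langle a\rangle\psi$ ($J\ne\emptyset$ at most countable), distribution formulae $\psi::=\bigoplus_{i\in I}r_i\varphi_i$ ($I$ finite nonempty, $r_i\in(0,1]$, $\sum r_i=1$); $s\models\top$ always; $s\models\neg\varphi$ iff not $s\models\varphi$; $s\models\bigwedge_j\varphi_j$ iff $s\models\varphi_j$ for all $j$; $s\models\langle a\rangle\psi$ iff $s\xrightarrow a\pi$ for some $\pi\models\psi$; $\pi\models\bigoplus_ir_i\varphi_i$ iff $\pi=\sum_ir_i\pi_i$ for some $\pi_i\in\Delta(\mathbf S)$ with $u\models\varphi_i$ for all $u\in\mathrm{supp}(\pi_i)$. Simulation characteristic formulae: $\vartheta_s^0=\top$; for $k\ge1$, $\vartheta_s^k=\bigwedge_{(s,a,\pi)\in\to}\langle a\rangle\upsilon_\pi^{k-1}$, where $\upsilon_\pi^k=\bigoplus_{u\in\mathrm{supp}(\pi)}\pi(u)\vartheta_u^k$ (an empty conjunction being read as $\top$). For finite $s$, $\vartheta_s=\vartheta_s^{\mathrm{depth}(s)}$. *)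

theory Defs
  imports "HOL-Probability.Probability"
begin

text \<open>
  Processes and actions range over types of class \<^class>\<open>countable\<close>, so a system is given by its
  transition relation.
\<close>

type_synonym ('s, 'a) trans_rel = "('s \<times> 'a \<times> 's pmf) set"

definition fin_dists :: "'s pmf set" where
  "fin_dists = {\<pi>. finite (set_pmf \<pi>)}"

definition pts :: "('s::countable, 'a::countable) trans_rel \<Rightarrow> bool" where
  "pts T \<longleftrightarrow> T \<subseteq> UNIV \<times> UNIV \<times> fin_dists"

definition init :: "('s, 'a) trans_rel \<Rightarrow> 's \<Rightarrow> 'a set" where
  "init T s = {a. \<exists>\<pi>. (s, a, \<pi>) \<in> T}"

definition der :: "('s, 'a) trans_rel \<Rightarrow> 's \<Rightarrow> 'a \<Rightarrow> 's pmf set" where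
  "der T s a = {\<pi>. (s, a, \<pi>) \<in> T}"

definition depth_step :: "('s, 'a) trans_rel \<Rightarrow> ('s \<Rightarrow> enat) \<Rightarrow> 's \<Rightarrow> enat" where
  "depth_step T d s =
     (if init T s = {} then 0
      else 1 + (SUP t \<in> (\<Union>a \<in> init T s. \<Union>\<pi> \<in> der T s a. set_pmf \<pi>). d t))"

text \<open>
  The recursive equation for the depth has exactly one solution in the extended naturals
  (\<open>depth_unfold\<close> and \<open>depth_unique\<close> below), so the choice of the least one is immaterial.
\<close>

definition depth :: "('s, 'a) trans_rel \<Rightarrow> 's \<Rightarrow> enat" where
  "depth T = lfp (depth_step T)"

lemma mono_depth_step: "mono (depth_step T)"
  by (rule monoI, rule le_funI)
     (auto simp: depth_step_def le_fun_def intro!: add_left_mono SUP_mono)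

lemma depth_unfold: "depth T s = depth_step T (depth T) s"
  unfolding depth_def using lfp_unfold[OF mono_depth_step] by metis

lemma depth_unique:
  assumes "\<And>s. d s = depth_step T d s"
  shows "d = depth T"
proof
  have ge: "depth T s \<le> d s" for s
  proof -
    have "depth_step T d = d" using assms by (intro ext) simp
    then show ?thesis unfolding depth_def using lfp_lowerbound[of "depth_step T" d]
      by (simp add: le_fun_def)
  qed
  have le: "d s \<le> enat n" if "depth T s \<le> enat n" for n s
    using that
  proof (induction n arbitrary: s)
    case 0
    then have "init T s = {}"
      using depth_unfold[of T s]
      by (auto simp: depth_step_def zero_enat_def[symmetric] split: if_splits)
    then show ?case using assms[of s] by (simp add: depth_step_def)
  next
    case (Suc n)
    show ?case
    proof (cases "init T s = {}")
      case True
      then show ?thesis using assms[of s] by (simp add: depth_step_def)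
    next
      case False
      let ?X = "\<Union>a \<in> init T s. \<Union>\<pi> \<in> der T s a. set_pmf \<pi>"
      have "1 + (SUP t \<in> ?X. depth T t) \<le> 1 + enat n"
        using Suc.prems depth_unfold[of T s] False
        by (simp add: depth_step_def one_enat_def)
      then have "(SUP t \<in> ?X. depth T t) \<le> enat n"
        by (cases "SUP t \<in> ?X. depth T t") (simp_all add: one_enat_def)
      then have "\<forall>t \<in> ?X. d t \<le> enat n"
        using Suc.IH by (meson SUP_le_iff)
      then have "(SUP t \<in> ?X. d t) \<le> enat n" by (meson SUP_least)
      then have "1 + (SUP t \<in> ?X. d t) \<le> 1 + enat n" by (rule add_left_mono)
      then show ?thesis using assms[of s] False
        by (simp add: depth_step_def one_enat_def)
    qed
  qed
  fix s
  show "d s = depth T s"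
  proof (cases "depth T s")
    case (enat n)
    then show ?thesis using le[of s n] ge[of s] by simp
  next
    case infinity
    then show ?thesis using ge[of s] by simp
  qed
qed

definition finite_process :: "('s, 'a) trans_rel \<Rightarrow> 's \<Rightarrow> bool" where
  "finite_process T s \<longleftrightarrow> (\<forall>a. finite (der T s a)) \<and> depth T s < \<infinity>"

text \<open>
  The weights \<open>p\<^sub>i\<close> form a probability mass function \<open>p\<close> on \<^typ>\<open>nat\<close> with index set
  \<open>I = set_pmf p\<close>; the convex combination of the Dirac distributions at the points \<open>\<sigma> i\<close> with
  weights \<open>p\<^sub>i\<close> is \<open>bind_pmf p (\<lambda>i. return_pmf (\<sigma> i))\<close>. As the weights sum up to 1, countable
  index sets suffice.
\<close>

definition lifting :: "('s \<Rightarrow> 's \<Rightarrow> bool) \<Rightarrow> 's pmf \<Rightarrow> 's pmf \<Rightarrow> bool" where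
  "lifting R \<pi> \<pi>' \<longleftrightarrow>
     (\<exists>(p :: nat pmf) \<sigma> \<tau>.
        \<pi> = bind_pmf p (\<lambda>i. return_pmf (\<sigma> i)) \<and>
        \<pi>' = bind_pmf p (\<lambda>i. return_pmf (\<tau> i)) \<and>
        (\<forall>i \<in> set_pmf p. R (\<sigma> i) (\<tau> i)))"

lemma lifting_eq_rel_pmf:
  fixes R :: "'s::countable \<Rightarrow> 's \<Rightarrow> bool"
  shows "lifting R = rel_pmf R"
proof (intro ext iffI)
  fix \<pi> \<pi>' :: "'s pmf"
  assume "lifting R \<pi> \<pi>'"
  then obtain p :: "nat pmf" and \<sigma> \<tau>
    where *: "\<pi> = map_pmf \<sigma> p" "\<pi>' = map_pmf \<tau> p" "\<forall>i \<in> set_pmf p. R (\<sigma> i) (\<tau> i)"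
    by (auto simp: lifting_def map_pmf_def)
  show "rel_pmf R \<pi> \<pi>'"
    by (rule rel_pmf.intros[of "map_pmf (\<lambda>i. (\<sigma> i, \<tau> i)) p"])
       (use * in \<open>auto simp: pmf.map_comp o_def\<close>)
next
  fix \<pi> \<pi>' :: "'s pmf"
  assume "rel_pmf R \<pi> \<pi>'"
  then obtain pq where *: "\<And>x y. (x, y) \<in> set_pmf pq \<Longrightarrow> R x y"
    "map_pmf fst pq = \<pi>" "map_pmf snd pq = \<pi>'"
    by (auto elim: rel_pmf.cases)
  show "lifting R \<pi> \<pi>'"
    unfolding lifting_def map_pmf_def[symmetric]
    by (rule exI[of _ "map_pmf to_nat pq"], rule exI[of _ "\<lambda>i. fst (from_nat i :: 's \<times> 's)"],
        rule exI[of _ "\<lambda>i. snd (from_nat i :: 's \<times> 's)"])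
       (use * in \<open>auto simp: pmf.map_comp o_def\<close>)
qed

definition prob_simulation :: "('s, 'a) trans_rel \<Rightarrow> ('s \<Rightarrow> 's \<Rightarrow> bool) \<Rightarrow> bool" where
  "prob_simulation T R \<longleftrightarrow>
     (\<forall>s t a \<pi>\<^sub>s. R s t \<longrightarrow> (s, a, \<pi>\<^sub>s) \<in> T \<longrightarrow> (\<exists>\<pi>\<^sub>t. (t, a, \<pi>\<^sub>t) \<in> T \<and> lifting R \<pi>\<^sub>s \<pi>\<^sub>t))"

definition sim :: "('s, 'a) trans_rel \<Rightarrow> 's \<Rightarrow> 's \<Rightarrow> bool" where
  "sim T s t \<longleftrightarrow> (\<exists>R. prob_simulation T R \<and> R s t)"

primrec sim_upto :: "('s, 'a) trans_rel \<Rightarrow> nat \<Rightarrow> 's \<Rightarrow> 's \<Rightarrow> bool" where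
  "sim_upto T 0 = (\<lambda>s t. True)"
| "sim_upto T (Suc k) = (\<lambda>s t.
     \<forall>a \<pi>\<^sub>s. (s, a, \<pi>\<^sub>s) \<in> T \<longrightarrow> (\<exists>\<pi>\<^sub>t. (t, a, \<pi>\<^sub>t) \<in> T \<and> lifting (sim_upto T k) \<pi>\<^sub>s \<pi>\<^sub>t))"

text \<open>
  \<open>Conj J \<phi>\<close> is the conjunction of the family \<open>\<phi>\<close> restricted to the index set \<open>J\<close>, and
  \<open>Oplus I r \<phi>\<close> the probabilistic choice over \<open>I\<close> with weights \<open>r\<close>. The conditions on index
  sets and weights are imposed by \<open>wf_sform\<close> and \<open>wf_dform\<close>.
\<close>

datatype ('a, 'j, 'i) sform =
    Top
  | Neg "('a, 'j, 'i) sform"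
  | Conj "'j set" "'j \<Rightarrow> ('a, 'j, 'i) sform"
  | Diam 'a "('a, 'j, 'i) dform"
and ('a, 'j, 'i) dform =
    Oplus "'i set" "'i \<Rightarrow> real" "'i \<Rightarrow> ('a, 'j, 'i) sform"

primrec wf_sform :: "('a, 'j, 'i) sform \<Rightarrow> bool"
  and wf_dform :: "('a, 'j, 'i) dform \<Rightarrow> bool" where
  "wf_sform Top \<longleftrightarrow> True"
| "wf_sform (Neg \<phi>) \<longleftrightarrow> wf_sform \<phi>"
| "wf_sform (Conj J \<phi>) \<longleftrightarrow> J \<noteq> {} \<and> countable J \<and> (\<forall>j \<in> J. wf_sform (\<phi> j))"
| "wf_sform (Diam a \<psi>) \<longleftrightarrow> wf_dform \<psi>"
| "wf_dform (Oplus I r \<phi>) \<longleftrightarrow>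
     finite I \<and> I \<noteq> {} \<and> (\<forall>i \<in> I. r i \<in> {0<..1} \<and> wf_sform (\<phi> i)) \<and> (\<Sum>i \<in> I. r i) = 1"

primrec sat :: "('s, 'a) trans_rel \<Rightarrow> ('a, 'j, 'i) sform \<Rightarrow> 's \<Rightarrow> bool"
  and dsat :: "('s, 'a) trans_rel \<Rightarrow> ('a, 'j, 'i) dform \<Rightarrow> 's pmf \<Rightarrow> bool" where
  "sat T Top = (\<lambda>s. True)"
| "sat T (Neg \<phi>) = (\<lambda>s. \<not> sat T \<phi> s)"
| "sat T (Conj J \<phi>) = (\<lambda>s. \<forall>j \<in> J. sat T (\<phi> j) s)"
| "sat T (Diam a \<psi>) = (\<lambda>s. \<exists>\<pi>. (s, a, \<pi>) \<in> T \<and> dsat T \<psi> \<pi>)"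
| "dsat T (Oplus I r \<phi>) = (\<lambda>\<pi>.
     \<exists>\<rho>. (\<forall>i \<in> I. \<rho> i \<in> fin_dists) \<and>
         (\<forall>u. pmf \<pi> u = (\<Sum>i \<in> I. r i * pmf (\<rho> i) u)) \<and>
         (\<forall>i \<in> I. \<forall>u \<in> set_pmf (\<rho> i). sat T (\<phi> i) u))"

text \<open>
  The transitions leaving \<open>s\<close> index the conjunction in \<open>theta T k s\<close>, and the processes in the
  support of \<open>\<pi>\<close> index the probabilistic choice in \<open>upsilon T k \<pi>\<close>. A process may have
  uncountably many transitions, in which case this conjunction is not countable; if there are only
  countably many, then \<open>theta T k s\<close> is a formula of the logic, see \<open>wf_theta\<close>.
\<close>

fun theta :: "('s, 'a) trans_rel \<Rightarrow> nat \<Rightarrow> 's \<Rightarrow> ('a, 'a \<times> 's pmf, 's) sform"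
  and upsilon :: "('s, 'a) trans_rel \<Rightarrow> nat \<Rightarrow> 's pmf \<Rightarrow> ('a, 'a \<times> 's pmf, 's) dform" where
  "theta T 0 s = Top"
| "theta T (Suc k) s =
     (if {(a, \<pi>). (s, a, \<pi>) \<in> T} = {} then Top
      else Conj {(a, \<pi>). (s, a, \<pi>) \<in> T} (\<lambda>(a, \<pi>). Diam a (upsilon T k \<pi>)))"
| "upsilon T k \<pi> = Oplus (set_pmf \<pi>) (pmf \<pi>) (\<lambda>u. theta T k u)"

lemma wf_theta:
  fixes T :: "('s::countable, 'a::countable) trans_rel"
  assumes "pts T" and "\<And>s. countable {(a, \<pi>). (s, a, \<pi>) \<in> T}"
  shows "wf_sform (theta T k s)"
proof (induction k arbitrary: s)
  case 0
  then show ?case by simp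
next
  case (Suc k)
  have "wf_dform (upsilon T k \<pi>)" if "(s, a, \<pi>) \<in> T" for a \<pi>
  proof -
    have fin: "finite (set_pmf \<pi>)" using assms(1) that by (auto simp: pts_def fin_dists_def)
    then show ?thesis
      using Suc by (simp add: set_pmf_not_empty pmf_positive pmf_le_1 sum_pmf_eq_1)
  qed
  then show ?case using assms(2)[of s] by auto
qed

definition char_formula :: "('s, 'a) trans_rel \<Rightarrow> 's \<Rightarrow> ('a, 'a \<times> 's pmf, 's) sform" where
  "char_formula T s = theta T (the_enat (depth T s)) s"

end

theory Submission
  imports Defs
begin

text \<open>
  Splitting a distribution \<open>\<pi>'\<close> as \<open>\<Sum>\<^sub>u \<pi>(u) \<cdot> \<rho>\<^sub>u\<close> amounts to giving a coupling of \<open>\<pi>\<close> and \<open>\<pi>'\<close>: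
  \<open>\<rho>\<^sub>u\<close> is the second marginal of the coupling conditioned on the first component being \<open>u\<close>. Hence
  satisfaction of \<open>\<upsilon>\<^bsub>\<pi>\<^esub>\<close> is the lifting of satisfaction of the formulae \<open>\<theta>\<^bsub>u\<^esub>\<close>, which gives the
  statement for up-to-\<open>k\<close> simulations by induction on \<open>k\<close>. For the last part, the pairs \<open>(s, t)\<close>
  such that \<open>t\<close> simulates \<open>s\<close> up to some \<open>n \<ge> depth s\<close> form a probabilistic simulation, because
  every transition decreases the depth.
\<close>

text \<open>Links bind with the pointwise sums in \<open>dsat\<close>: finite support turns the
  integral of \<open>pmf_bind\<close> into a sum.\<close>

lemma bind_pmf_eq_iff_pmf_sum:
  assumes "finite (set_pmf p)"
  shows "q = bind_pmf p f \<longleftrightarrow> (\<forall>u. pmf q u = (\<Sum>i \<in> set_pmf p. pmf p i * pmf (f i) u))"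
proof -
  have "pmf (bind_pmf p f) u = (\<Sum>i \<in> set_pmf p. pmf p i * pmf (f i) u)" for u
    unfolding pmf_bind
    by (subst integral_measure_pmf_real[OF assms]) (auto simp: mult.commute)
  then show ?thesis by (auto intro: pmf_eqI)
qed

lemma rel_pmf_iff_bind_pmf:
  "rel_pmf R p q \<longleftrightarrow>
     (\<exists>f. q = bind_pmf p f \<and> (\<forall>x \<in> set_pmf p. \<forall>y \<in> set_pmf (f x). R x y))"
proof
  assume "rel_pmf R p q"
  then obtain pq where R: "\<And>x y. (x, y) \<in> set_pmf pq \<Longrightarrow> R x y"
    and p: "map_pmf fst pq = p" and q: "map_pmf snd pq = q"
    by (auto elim: rel_pmf.cases)
  define c where "c x = cond_pmf pq {z. fst z = x}" for x
  have ne: "set_pmf pq \<inter> {z. fst z = x} \<noteq> {}" if "x \<in> set_pmf p" for x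
    using that p by force
  have "bind_pmf p c = pq"
    unfolding c_def
  proof (rule bind_cond_pmf_cancel)
    fix x z assume "z \<in> set_pmf pq" "fst z = x"
    then have "{x. fst z = x} = {x}"
      by auto
    \<comment> \<open>Both sides are the mass of \<open>x\<close> under \<open>p\<close>, the first
      marginal of \<open>pq\<close>.\<close>
    then show "measure pq {z. fst z = x} = measure p {x. fst z = x}"
      by (simp add: p[symmetric] vimage_def)
  qed (use p ne in force)+
  then have "q = bind_pmf p (\<lambda>x. map_pmf snd (c x))"
    using q by (simp add: map_bind_pmf[symmetric])
  moreover have "R x y" if "x \<in> set_pmf p" "y \<in> set_pmf (map_pmf snd (c x))" for x y
    using that R ne[OF that(1)] by (auto simp: c_def set_cond_pmf)
  ultimately show "\<exists>f. q = bind_pmf p f \<and> (\<forall>x \<in> set_pmf p. \<forall>y \<in> set_pmf (f x). R x y)"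
    by blast
next
  assume "\<exists>f. q = bind_pmf p f \<and> (\<forall>x \<in> set_pmf p. \<forall>y \<in> set_pmf (f x). R x y)"
  then obtain f where q: "q = bind_pmf p f"
    and R: "\<And>x y. x \<in> set_pmf p \<Longrightarrow> y \<in> set_pmf (f x) \<Longrightarrow> R x y"
    by blast
  \<comment> \<open>The diagonal coupling records membership in the support, since \<open>R\<close>
    is known for \<open>f x\<close> only there.\<close>
  have "rel_pmf (\<lambda>x y. x = y \<and> x \<in> set_pmf p) p p"
    by (rule rel_pmf_reflI) simp
  then have "rel_pmf R (bind_pmf p return_pmf) (bind_pmf p f)"
    by (rule rel_pmf_bindI) (auto simp: rel_pmf_return_pmf1 intro: R)
  then show "rel_pmf R p q"
    by (simp add: q bind_return_pmf')
qed

lemma dsat_Oplus_pmf_iff: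
  assumes "finite (set_pmf \<pi>)" "finite (set_pmf \<pi>')"
  shows "dsat T (Oplus (set_pmf \<pi>) (pmf \<pi>) \<phi>) \<pi>' \<longleftrightarrow> rel_pmf (\<lambda>u. sat T (\<phi> u)) \<pi> \<pi>'"
proof -
  \<comment> \<open>Each \<open>\<rho> u\<close> has positive weight, so its support lies in that of
    \<open>\<pi>'\<close>.\<close>
  have "\<forall>u \<in> set_pmf \<pi>. \<rho> u \<in> fin_dists" if "\<pi>' = bind_pmf \<pi> \<rho>" for \<rho>
    using assms(2) that by (auto simp: fin_dists_def intro: finite_subset)
  then show ?thesis
    by (auto simp: rel_pmf_iff_bind_pmf bind_pmf_eq_iff_pmf_sum[OF assms(1), symmetric])
qed

lemma sat_theta_iff_sim_upto:
  fixes T :: "('s::countable, 'a::countable) trans_rel"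
  assumes "pts T"
  shows "sat T (theta T k s) t \<longleftrightarrow> sim_upto T k s t"
proof (induction k arbitrary: s t)
  case (Suc k)
  have fin: "finite (set_pmf \<pi>)" if "(s, a, \<pi>) \<in> T" for s a \<pi>
    using assms that by (auto simp: pts_def fin_dists_def)
  have "dsat T (upsilon T k \<pi>) \<pi>' \<longleftrightarrow> lifting (sim_upto T k) \<pi> \<pi>'"
    if "(s, a, \<pi>) \<in> T" "(t, a, \<pi>') \<in> T" for a \<pi> \<pi>'
    using dsat_Oplus_pmf_iff[OF that[THEN fin], of T "theta T k"]
    unfolding Suc.IH lifting_eq_rel_pmf upsilon.simps .
  then have "(\<exists>\<pi>'. (t, a, \<pi>') \<in> T \<and> dsat T (upsilon T k \<pi>) \<pi>') \<longleftrightarrow>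
      (\<exists>\<pi>'. (t, a, \<pi>') \<in> T \<and> lifting (sim_upto T k) \<pi> \<pi>')" if "(s, a, \<pi>) \<in> T" for a \<pi>
    using that by blast
  then show ?case by (auto simp del: upsilon.simps)
qed simp

text \<open>Lifting is monotone, so by induction on \<open>k\<close> a simulation is contained in
  every \<open>sim_upto T k\<close>.\<close>

lemma sim_imp_sim_upto:
  fixes T :: "('s::countable, 'a) trans_rel"
  assumes "sim T s t"
  shows "sim_upto T k s t"
proof -
  obtain R where R: "prob_simulation T R" "R s t"
    using assms by (auto simp: sim_def)
  have "R s t \<Longrightarrow> sim_upto T k s t" for s t
  proof (induction k arbitrary: s t)
    case (Suc k)
    then have "lifting R \<pi> \<pi>' \<Longrightarrow> lifting (sim_upto T k) \<pi> \<pi>'" for \<pi> \<pi>'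
      unfolding lifting_eq_rel_pmf by (auto elim: pmf.rel_mono_strong)
    then show ?case
      using R(1) Suc.prems unfolding prob_simulation_def by simp blast
  qed simp
  with R(2) show ?thesis by blast
qed

text \<open>The form with \<open>1 +\<close> also covers infinite depths, where no strict decrease
  holds.\<close>

lemma depth_transition:
  assumes "(s, a, \<pi>) \<in> T" "u \<in> set_pmf \<pi>"
  shows "1 + depth T u \<le> depth T s"
proof -
  have "init T s \<noteq> {}"
    using assms(1) by (auto simp: init_def)
  moreover have "u \<in> (\<Union>a \<in> init T s. \<Union>\<pi> \<in> der T s a. set_pmf \<pi>)"
    using assms by (auto simp: init_def der_def)
  ultimately show ?thesis
    by (subst (2) depth_unfold) (auto simp: depth_step_def intro!: add_left_mono SUP_upper)
qed

lemma sim_upto_imp_sim: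
  fixes T :: "('s::countable, 'a) trans_rel"
  assumes "depth T s \<le> enat n" "sim_upto T n s t"
  shows "sim T s t"
proof -
  \<comment> \<open>No fixed \<open>n\<close> would do: after a transition only the bound
    \<open>n - 1\<close> is available, for the depth and for the simulation alike.\<close>
  define R where "R s t \<longleftrightarrow> (\<exists>n. depth T s \<le> enat n \<and> sim_upto T n s t)" for s t
  have "\<exists>\<pi>'. (t, a, \<pi>') \<in> T \<and> lifting R \<pi> \<pi>'" if st: "R s t" and tr: "(s, a, \<pi>) \<in> T" for s t a \<pi>
  proof -
    obtain n where n: "depth T s \<le> enat n" "sim_upto T n s t"
      using st by (auto simp: R_def)
    have d: "1 + depth T u \<le> enat n" if "u \<in> set_pmf \<pi>" for u
      using depth_transition[OF tr that] n(1) by (rule order_trans)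
    \<comment> \<open>Any point of the support forces \<open>n\<close> to be positive.\<close>
    obtain u where "u \<in> set_pmf \<pi>"
      using set_pmf_not_empty[of \<pi>] by blast
    from d[OF this] obtain m where m: "n = Suc m"
      by (cases n; cases "depth T u") (auto simp: one_enat_def)
    have "depth T u \<le> enat m" if "u \<in> set_pmf \<pi>" for u
      using d[OF that] m by (cases "depth T u") (auto simp: one_enat_def)
    moreover obtain \<pi>' where "(t, a, \<pi>') \<in> T" "lifting (sim_upto T m) \<pi> \<pi>'"
      using n(2) tr m by auto
    ultimately have "lifting R \<pi> \<pi>'"
      unfolding lifting_eq_rel_pmf by (auto simp: R_def elim!: pmf.rel_mono_strong intro!: exI[of _ m])
    with \<open>(t, a, \<pi>') \<in> T\<close> show ?thesis by blast
  qed
  then have "prob_simulation T R"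
    by (auto simp: prob_simulation_def)
  moreover have "R s t"
    using assms by (auto simp: R_def)
  ultimately show ?thesis
    by (auto simp: sim_def)
qed

theorem theorem5:
  fixes T :: "('s::countable, 'a::countable) trans_rel"
  assumes "pts T"
  shows "(\<forall>s t k. sat T (theta T k s) t \<longleftrightarrow> sim_upto T k s t) \<and>
         (\<forall>s t. finite_process T s \<longrightarrow> (sat T (char_formula T s) t \<longleftrightarrow> sim T s t))"
proof -
  have "sat T (char_formula T s) t \<longleftrightarrow> sim T s t" if "finite_process T s" for s t
  proof -
    \<comment> \<open>Finite depth makes \<open>the_enat\<close> return the depth itself; at
      infinity its value is unspecified.\<close>
    have "depth T s \<le> enat (the_enat (depth T s))"
      using that by (cases "depth T s") (auto simp: finite_process_def)
    then show ?thesis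
      unfolding char_formula_def sat_theta_iff_sim_upto[OF assms]
      using sim_upto_imp_sim sim_imp_sim_upto by blast
  qed
  then show ?thesis
    using sat_theta_iff_sim_upto[OF assms] by blast
qed

end
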